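(* Let $1<n<\omega$, let $\kappa$ be a cardinal with $\omega\le\kappa<2^\omega$, and assume $MA_\kappa(\sigma\text{-centered})$. Then there exists a simple $\kappa$-fold cover of $\mathbb{R}^n$ by closed sets, all isometric copies of one compact convex set, which cannot be decomposed into two disjoint subcovers; i.e. there is a family $\mathcal H$ of isometric copies of a fixed compact convex set $C\subseteq\mathbb R^n$ such that every point of $\mathbb R^n$ lies in at least $\kappa$ members of $\mathcal H$, but there is no partition of $\mathcal H$ into two disjoint subfamilies each covering $\mathbb R^n$.
   Context: $MA_\kappa(\sigma\text{-centered})$ is Martin's Axiom for $\sigma$-centered posets and families of at most $\kappa$ dense sets. *)

theory Defs
  imports "HOL-Analysis.Analysis"
begin

unbundle cardinal_syntax

text \<open>
  A poset is a set \<open>P\<close> together with a relation \<open>r\<close> such that \<open>partial_order_on P r\<close>. The forcing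
  convention is used: \<open>(q, p) \<in> r\<close> means \<open>q \<le> p\<close>, i.e. \<open>q\<close> is a stronger condition than \<open>p\<close>.
\<close>

definition centered_in :: "'p set \<Rightarrow> 'p rel \<Rightarrow> 'p set \<Rightarrow> bool" where
  "centered_in P r A \<longleftrightarrow>
     A \<subseteq> P \<and> (\<forall>F. finite F \<and> F \<subseteq> A \<longrightarrow> (\<exists>q\<in>P. \<forall>p\<in>F. (q, p) \<in> r))"

definition sigma_centered :: "'p set \<Rightarrow> 'p rel \<Rightarrow> bool" where
  "sigma_centered P r \<longleftrightarrow>
     (\<exists>A :: nat \<Rightarrow> 'p set. (\<forall>i. centered_in P r (A i)) \<and> P = (\<Union>i. A i))"

definition dense_in_poset :: "'p set \<Rightarrow> 'p rel \<Rightarrow> 'p set \<Rightarrow> bool" where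
  "dense_in_poset P r D \<longleftrightarrow> D \<subseteq> P \<and> (\<forall>p\<in>P. \<exists>d\<in>D. (d, p) \<in> r)"

definition poset_filter :: "'p set \<Rightarrow> 'p rel \<Rightarrow> 'p set \<Rightarrow> bool" where
  "poset_filter P r G \<longleftrightarrow>
     G \<subseteq> P \<and> G \<noteq> {} \<and>
     (\<forall>p\<in>G. \<forall>q\<in>P. (p, q) \<in> r \<longrightarrow> q \<in> G) \<and>
     (\<forall>p\<in>G. \<forall>q\<in>G. \<exists>s\<in>G. (s, p) \<in> r \<and> (s, q) \<in> r)"

text \<open>
  \<open>MA_sigma_centered TYPE('p) \<kappa>\<close> is Martin's Axiom for \<open>\<sigma>\<close>-centered posets whose underlying set is
  a subset of the type \<open>'p\<close>, and families of at most \<open>\<kappa>\<close> dense sets. HOL cannot quantify over all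
  types inside a formula, so the type is a parameter. Taking \<open>'p = real\<close> gives the axiom for all
  (up to isomorphism) \<open>\<sigma>\<close>-centered posets of size at most the continuum. This is implied by
  the axiom for \<open>\<sigma>\<close>-centered posets of arbitrary size (and, for infinite \<open>\<kappa>\<close> below the
  continuum, is equivalent to it by passing to a suitable subposet of size at most \<open>\<kappa>\<close>), so using it as a
  hypothesis is no restriction.
\<close>

definition MA_sigma_centered :: "'p itself \<Rightarrow> 'k rel \<Rightarrow> bool" where
  "MA_sigma_centered _ \<kappa> \<longleftrightarrow>
     (\<forall>(P :: 'p set) r \<D>.
        P \<noteq> {} \<and> partial_order_on P r \<and> sigma_centered P r \<and>
        |\<D>| \<le>o \<kappa> \<and> (\<forall>D\<in>\<D>. dense_in_poset P r D) \<longrightarrow>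
        (\<exists>G. poset_filter P r G \<and> (\<forall>D\<in>\<D>. G \<inter> D \<noteq> {})))"

definition isometric_copy :: "'a::metric_space set \<Rightarrow> 'b::metric_space set \<Rightarrow> bool" where
  "isometric_copy C A \<longleftrightarrow>
     (\<exists>f. (\<forall>x\<in>C. \<forall>y\<in>C. dist (f x) (f y) = dist x y) \<and> f ` C = A)"

text \<open>
  Covers are sets of sets, hence automatically simple: no member is repeated.
\<close>

definition fold_cover :: "'k rel \<Rightarrow> 'a set set \<Rightarrow> bool" where
  "fold_cover \<kappa> \<H> \<longleftrightarrow> (\<forall>x. \<kappa> \<le>o |{A \<in> \<H>. x \<in> A}| )"

definition splits_into_two_covers :: "'a set set \<Rightarrow> bool" where
  "splits_into_two_covers \<H> \<longleftrightarrow>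
     (\<exists>\<H>\<^sub>1 \<H>\<^sub>2. \<H>\<^sub>1 \<union> \<H>\<^sub>2 = \<H> \<and> \<H>\<^sub>1 \<inter> \<H>\<^sub>2 = {} \<and> \<Union>\<H>\<^sub>1 = UNIV \<and> \<Union>\<H>\<^sub>2 = UNIV)"

end

theory Submission
  imports Defs
begin

text \<open>
  Choose \<open>\<kappa>\<close> branches of the binary tree. Solovay's almost disjoint coding, an instance of
  \<open>MA\<close> for a \<open>\<sigma>\<close>-centered poset, yields for every 2-colouring of the pairs
  \<open>(\<alpha>, n)\<close> of a chosen branch and a level a set \<open>x\<close> of nodes such that on \<open>\<kappa>\<close> many branches
  there is a last node in \<open>x\<close>, all the corresponding pairs have the same colour, and no other
  chosen branch has a last node in \<open>x\<close>.

  Writing pairs and node sets as reals with digits at disjoint places, the relation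
  ``node \<open>n\<close> is the last one of branch \<open>\<alpha>\<close> in \<open>x\<close>'' becomes \<open>\<phi> x + \<psi> (\<alpha>, n) \<in> E\<close> for one compact set
  \<open>E\<close> of reals. Wrap the line around a unit circle and let \<open>C\<close> be the convex hull of the image of \<open>E\<close>:
  by strict convexity its rotation by \<open>- \<psi> (\<alpha>, n)\<close> contains the point at angle \<open>\<phi> x\<close> iff the relation
  holds. Finally let \<open>X\<close> be the set of unit vectors lying in at least \<open>\<kappa>\<close> of these rotations and add
  all copies of \<open>C\<close> that avoid \<open>X\<close>. They cover the complement of \<open>X\<close> continuum many times, since
  \<open>C\<close> can be moved to touch the unit sphere from outside along an edge, or into the open unit ball.
  A splitting of the family colours the rotations, and the coding provides a point of \<open>X\<close> all of whose
  members lie in the same part.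
\<close>

section \<open>Reals with prescribed digits\<close>

text \<open>
  Only the digits 0 and 1 occur in base 4, so sets that differ at a digit have sums a definite distance
  apart. The factor \<open>1/20\<close> keeps all values below \<open>1/15\<close>, so that they can serve as small angles.
\<close>
definition digit_sum :: "'d::countable set \<Rightarrow> real" where
  "digit_sum u = (\<Sum>k. (if k \<in> to_nat ` u then 1 else 0) * ((1/4) ^ k / 20))"

text \<open>Coefficients of either sign are allowed because differences of digit sequences are
  summed as well.\<close>

lemma summable_digits:
  assumes "\<And>k. \<bar>a k\<bar> \<le> 1"
  shows "summable (\<lambda>k. a k * ((1/4::real) ^ k / 20))"
proof (rule summable_comparison_test')
  show "summable (\<lambda>k. (1/4::real) ^ k)" by (simp add: summable_geometric)
  fix k :: nat
  have "\<bar>a k\<bar> * ((1/4::real) ^ k / 20) \<le> 1 * (1/4::real) ^ k"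
    using assms[of k] by (intro mult_mono) auto
  then show "norm (a k * ((1/4::real) ^ k / 20)) \<le> (1/4) ^ k"
    by (simp add: abs_mult)
qed

lemma digit_sum_Un:
  assumes "u \<inter> w = {}"
  shows "digit_sum (u \<union> w) = digit_sum u + digit_sum w"
proof -
  have "k \<in> to_nat ` u \<Longrightarrow> k \<notin> to_nat ` w" for k
    using assms by auto
  then have *: "(if k \<in> to_nat ` (u \<union> w) then 1 else 0) * ((1/4::real) ^ k / 20) =
      (if k \<in> to_nat ` u then 1 else 0) * ((1/4) ^ k / 20) +
      (if k \<in> to_nat ` w then 1 else 0) * ((1/4) ^ k / 20)" for k
    by (auto simp: image_Un)
  then show ?thesis
    unfolding digit_sum_def * by (subst suminf_add[OF summable_digits summable_digits]) auto
qed

lemma digit_sum_bounds: "0 \<le> digit_sum u" "digit_sum u \<le> 1/15"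
proof -
  show "0 \<le> digit_sum u"
    unfolding digit_sum_def by (intro suminf_nonneg summable_digits) auto
  have "digit_sum u \<le> (\<Sum>k. 1 * ((1/4::real) ^ k / 20))"
    unfolding digit_sum_def by (intro suminf_le summable_digits) auto
  also have "\<dots> = (\<Sum>k. (1/4::real) ^ k) / 20"
    using suminf_divide[of "\<lambda>k. (1/4::real)^k" 20] by (simp add: summable_geometric)
  also have "\<dots> = 1/15"
    by (subst suminf_geometric) auto
  finally show "digit_sum u \<le> 1/15" .
qed

text \<open>At the first place \<open>m\<close> where the digits differ, the terms are
  \<open>(1/4) ^ m / 20\<close> apart, while all later places together contribute at most
  \<open>(1/4) ^ m / 60\<close>. A gap of at least \<open>(1/4) ^ m / 30\<close> remains, and
  \<open>m\<close> is at most \<open>to_nat x\<close>.\<close>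

lemma digit_sum_gap:
  assumes "x \<in> u \<longleftrightarrow> x \<notin> w"
  shows "(1/4) ^ to_nat x / 60 \<le> \<bar>digit_sum u - digit_sum w\<bar>"
proof -
  define a :: "nat \<Rightarrow> real" where
    "a k = (if k \<in> to_nat ` u then 1 else 0) - (if k \<in> to_nat ` w then 1 else 0)" for k
  have a1: "\<bar>a k\<bar> \<le> 1" for k by (auto simp: a_def)
  have eq: "digit_sum u - digit_sum w = (\<Sum>k. a k * ((1/4) ^ k / 20))"
    unfolding digit_sum_def a_def
    by (subst suminf_diff[OF summable_digits summable_digits]) (auto simp only: left_diff_distrib abs_one abs_zero split: if_splits)
  have "to_nat x \<in> to_nat ` u \<longleftrightarrow> x \<in> u" "to_nat x \<in> to_nat ` w \<longleftrightarrow> x \<in> w"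
    using inj_to_nat by (auto simp: inj_def)
  then have "a (to_nat x) \<noteq> 0" using assms by (auto simp: a_def)
  \<comment> \<open>The sets may already differ at a place before that of \<open>x\<close>, so the
    estimate is made at the first difference.\<close>
  define m where "m = (LEAST k. a k \<noteq> 0)"
  have am: "a m \<noteq> 0" unfolding m_def by (rule LeastI) fact
  have mx: "m \<le> to_nat x" unfolding m_def by (rule Least_le) fact
  have below: "a k = 0" if "k < m" for k using not_less_Least that unfolding m_def by blast
  have am1: "\<bar>a m\<bar> = 1" using am by (auto simp: a_def split: if_splits)
  define tl where "tl = (\<Sum>k. a (k + Suc m) * ((1/4) ^ (k + Suc m) / 20))"
  have "(\<Sum>k. a k * ((1/4) ^ k / 20)) = tl + (\<Sum>k<Suc m. a k * ((1/4) ^ k / 20))"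
    unfolding tl_def by (rule suminf_split_initial_segment) (rule summable_digits[OF a1])
  also have "(\<Sum>k<Suc m. a k * ((1/4) ^ k / 20)) = a m * ((1/4) ^ m / 20)"
    using below by simp
  finally have split: "digit_sum u - digit_sum w = tl + a m * ((1/4) ^ m / 20)" using eq by simp
  have s: "summable (\<lambda>k. (1/4::real) ^ k * ((1/4) ^ Suc m / 20))"
    by (intro summable_mult2 summable_geometric) auto
  have "a (k + Suc m) * ((1/4) ^ (k + Suc m) / 20) \<le> (1/4) ^ k * ((1/4) ^ Suc m / 20)"
    "- ((1/4) ^ k * ((1/4) ^ Suc m / 20)) \<le> a (k + Suc m) * ((1/4) ^ (k + Suc m) / 20)" for k
    using mult_right_mono[of "a (k + Suc m)" 1 "(1/4) ^ (k + Suc m) / 20"]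
      mult_right_mono[of "-1" "a (k + Suc m)" "(1/4) ^ (k + Suc m) / 20"] a1[of "k + Suc m"]
    by (auto simp: power_add abs_le_iff)
  moreover have sa: "summable (\<lambda>k. a (k + Suc m) * ((1/4) ^ (k + Suc m) / 20))"
    by (subst summable_iff_shift) (rule summable_digits[OF a1])
  ultimately have "tl \<le> (\<Sum>k. (1/4) ^ k * ((1/4) ^ Suc m / 20))"
    "(\<Sum>k. - ((1/4) ^ k * ((1/4) ^ Suc m / 20))) \<le> tl"
    unfolding tl_def using s by (auto intro!: suminf_le summable_minus)
  moreover have "(\<Sum>k. (1/4::real) ^ k * ((1/4) ^ Suc m / 20)) = (1/4) ^ m / 60"
    by (subst suminf_mult2[symmetric]) (auto simp: summable_geometric suminf_geometric)
  ultimately have "\<bar>tl\<bar> \<le> (1/4) ^ m / 60"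
    using s by (simp add: suminf_minus)
  moreover have "\<bar>a m * ((1/4) ^ m / 20)\<bar> = (1/4) ^ m / 20"
    using am1 by (simp add: abs_mult)
  ultimately have "(1/4) ^ m / 30 \<le> \<bar>digit_sum u - digit_sum w\<bar>"
    unfolding split by linarith
  moreover have "(1/4::real) ^ to_nat x \<le> (1/4) ^ m"
    using mx by (intro power_decreasing) auto
  ultimately show ?thesis
    using zero_le_power[of "1/4::real" m] by linarith
qed

lemma inj_digit_sum: "inj digit_sum"
proof (rule injI, rule ccontr)
  fix u w :: "'a set"
  assume eq: "digit_sum u = digit_sum w" and "u \<noteq> w"
  then obtain x where "x \<in> u \<longleftrightarrow> x \<notin> w" by blast
  from digit_sum_gap[OF this] show False
    using eq zero_less_power[of "1/4::real" "to_nat x"] by linarith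
qed

text \<open>By the gap estimate, sums that are close enough come from sets with the same digits at
  finitely many given places. Hence any property of a limit that depends on finitely many digits is
  inherited from a member of \<open>U\<close>.\<close>

lemma digit_sum_closure:
  assumes "digit_sum u \<in> closure (digit_sum ` U)" and "finite I"
  obtains w where "w \<in> U" "w \<inter> I = u \<inter> I"
proof -
  \<comment> \<open>The smallest of the gaps for elements of \<open>I\<close>; the extra 1 gives
    \<open>Min\<close> a nonempty set when \<open>I\<close> is empty.\<close>
  define e :: real where "e = Min (insert 1 ((\<lambda>x. (1/4) ^ to_nat x / 60) ` I))"
  have fin: "finite (insert 1 ((\<lambda>x. (1/4::real) ^ to_nat x / 60) ` I))" using assms(2) by simp
  have "e > 0" unfolding e_def using assms(2) by (subst Min_gr_iff) auto
  then obtain w where w: "w \<in> U" "dist (digit_sum w) (digit_sum u) < e"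
    using assms(1) unfolding closure_approachable by blast
  have "x \<in> w \<longleftrightarrow> x \<in> u" if "x \<in> I" for x
  proof (rule ccontr)
    assume "\<not> ?thesis"
    then have "(1/4) ^ to_nat x / 60 \<le> \<bar>digit_sum w - digit_sum u\<bar>"
      by (intro digit_sum_gap) auto
    moreover have "e \<le> (1/4) ^ to_nat x / 60"
      unfolding e_def using fin that by (intro Min_le) auto
    ultimately show False using w(2) by (simp add: dist_real_def)
  qed
  then show ?thesis using that w(1) by blast
qed

section \<open>Almost disjoint coding\<close>

text \<open>The axiom speaks about one fixed type. The injection \<open>f\<close> carries a poset on
  any other type over to it, and the resulting filter is pulled back.\<close>

lemma MA_sigma_centered_filter:
  fixes le :: "'q \<Rightarrow> 'q \<Rightarrow> bool" and \<kappa> :: "'k rel" and D :: "'i \<Rightarrow> 'q \<Rightarrow> bool"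
    and A :: "nat \<Rightarrow> 'q set"
  assumes MA: "MA_sigma_centered TYPE('p) \<kappa>"
    and f: "inj_on (f :: 'q \<Rightarrow> 'p) P" and ne: "P \<noteq> {}"
    and refl: "\<And>p. p \<in> P \<Longrightarrow> le p p"
    and trans: "\<And>p q s. \<lbrakk>p \<in> P; q \<in> P; s \<in> P; le p q; le q s\<rbrakk> \<Longrightarrow> le p s"
    and antisym: "\<And>p q. \<lbrakk>p \<in> P; q \<in> P; le p q; le q p\<rbrakk> \<Longrightarrow> p = q"
    and PA: "P = (\<Union>i. A i)"
    and centered: "\<And>i F. finite F \<Longrightarrow> F \<subseteq> A i \<Longrightarrow> \<exists>q\<in>P. \<forall>p\<in>F. le q p"
    and card: "|I| \<le>o \<kappa>"
    and dense: "\<And>i p. i \<in> I \<Longrightarrow> p \<in> P \<Longrightarrow> \<exists>d\<in>P. le d p \<and> D i d"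
  shows "\<exists>G\<subseteq>P. G \<noteq> {} \<and> (\<forall>p\<in>G. \<forall>q\<in>G. \<exists>s\<in>G. le s p \<and> le s q) \<and> (\<forall>i\<in>I. \<exists>d\<in>G. D i d)"
proof -
  define r where "r = {(f p, f q) | p q. p \<in> P \<and> q \<in> P \<and> le p q}"
  have r: "(f p, f q) \<in> r \<longleftrightarrow> le p q" if "p \<in> P" "q \<in> P" for p q
    using that inj_onD[OF f] unfolding r_def by blast
  define E where "E i = f ` {d \<in> P. D i d}" for i
  have "partial_order_on (f ` P) r"
    unfolding partial_order_on_def preorder_on_def
  proof (intro conjI)
    show "r \<subseteq> f ` P \<times> f ` P" unfolding r_def by auto
    show "refl_on (f ` P) r" unfolding refl_on_def using r refl by auto
    show "trans r"
    proof (rule transI)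
      fix x y z assume "(x, y) \<in> r" "(y, z) \<in> r"
      then obtain p q q' s where "x = f p" "y = f q" "y = f q'" "z = f s" "p \<in> P" "q \<in> P" "q' \<in> P"
        "s \<in> P" "le p q" "le q' s" unfolding r_def by blast
      then show "(x, z) \<in> r" using inj_onD[OF f, of q q'] r trans[of p q s] by auto
    qed
    show "antisym r"
    proof (rule antisymI)
      fix x y assume "(x, y) \<in> r" "(y, x) \<in> r"
      then obtain p q where "x = f p" "y = f q" "p \<in> P" "q \<in> P" unfolding r_def by blast
      then show "x = y" using \<open>(x, y) \<in> r\<close> \<open>(y, x) \<in> r\<close> r antisym[of p q] by auto
    qed
  qed
  moreover have "sigma_centered (f ` P) r"
    unfolding sigma_centered_def centered_in_def
  proof (intro exI[of _ "\<lambda>i. f ` A i"] conjI allI impI)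
    show "f ` A i \<subseteq> f ` P" for i using PA by blast
    show "f ` P = (\<Union>i. f ` A i)" using PA by blast
    fix i F assume "finite F \<and> F \<subseteq> f ` A i"
    then obtain F' where F': "F' \<subseteq> A i" "finite F'" "F = f ` F'"
      using finite_subset_image by metis
    then obtain q where "q \<in> P" "\<forall>p\<in>F'. le q p" using centered by blast
    then show "\<exists>q\<in>f ` P. \<forall>p\<in>F. (q, p) \<in> r" using F' PA r by blast
  qed
  moreover have "|E ` I| \<le>o \<kappa>" using card_of_image card ordLeq_transitive by blast
  moreover have "\<forall>X\<in>E ` I. dense_in_poset (f ` P) r X"
    unfolding dense_in_poset_def E_def using dense r by fastforce
  ultimately obtain G where G: "poset_filter (f ` P) r G" "\<forall>X\<in>E ` I. G \<inter> X \<noteq> {}"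
    using MA ne unfolding MA_sigma_centered_def by (metis image_is_empty)
  have GP: "G \<subseteq> f ` P" and Gne: "G \<noteq> {}"
    and Gdir: "\<And>p q. p \<in> G \<Longrightarrow> q \<in> G \<Longrightarrow> \<exists>s\<in>G. (s, p) \<in> r \<and> (s, q) \<in> r"
    using G(1) unfolding poset_filter_def by auto
  show ?thesis
  proof (intro exI[of _ "{p \<in> P. f p \<in> G}"] conjI ballI)
    show "{p \<in> P. f p \<in> G} \<subseteq> P" "{p \<in> P. f p \<in> G} \<noteq> {}" using GP Gne by auto
    fix p q assume "p \<in> {p \<in> P. f p \<in> G}" "q \<in> {p \<in> P. f p \<in> G}"
    then show "\<exists>s\<in>{p \<in> P. f p \<in> G}. le s p \<and> le s q"
      using Gdir[of "f p" "f q"] GP r by blast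
  next
    fix i assume "i \<in> I"
    then obtain y where "y \<in> G" "y \<in> E i" using G(2) by blast
    then show "\<exists>d\<in>{p \<in> P. f p \<in> G}. D i d" unfolding E_def by auto
  qed
qed

section \<open>Branches and nodes of the binary tree\<close>

definition node :: "(nat \<Rightarrow> bool) \<Rightarrow> nat \<Rightarrow> bool list" where
  "node \<alpha> n = map \<alpha> [0..<n]"

lemma length_node [simp]: "length (node \<alpha> n) = n"
  by (simp add: node_def)

lemma node_eq_iff: "node \<alpha> n = node \<beta> m \<longleftrightarrow> n = m \<and> (\<forall>i<n. \<alpha> i = \<beta> i)"
  unfolding node_def by (auto simp: list_eq_iff_nth_eq)

definition last_node :: "bool list set \<Rightarrow> (nat \<Rightarrow> bool) \<Rightarrow> nat \<Rightarrow> bool" where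
  "last_node x \<alpha> n \<longleftrightarrow> node \<alpha> n \<in> x \<and> (\<forall>m>n. node \<alpha> m \<notin> x)"

lemma last_node_unique: "last_node x \<alpha> n \<Longrightarrow> last_node x \<alpha> m \<Longrightarrow> n = m"
  unfolding last_node_def by (metis linorder_neqE_nat)

text \<open>Two branches share no node beyond a place where they differ. For finitely many branches,
  the sum of such places bounds them all.\<close>

lemma branches_separate:
  assumes "finite F" and "\<alpha> \<notin> F"
  obtains N where "\<And>n \<beta> m. n \<ge> N \<Longrightarrow> \<beta> \<in> F \<Longrightarrow> node \<alpha> n \<noteq> node \<beta> m"
proof -
  have "\<exists>i. \<alpha> i \<noteq> \<beta> i" if "\<beta> \<in> F" for \<beta>
  proof -
    have "\<alpha> \<noteq> \<beta>" using that assms(2) by blast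
    then show ?thesis by (simp add: fun_eq_iff)
  qed
  then obtain k where k: "\<And>\<beta>. \<beta> \<in> F \<Longrightarrow> \<alpha> (k \<beta>) \<noteq> \<beta> (k \<beta>)" by metis
  have "k \<beta> < Suc (\<Sum>\<gamma>\<in>F. k \<gamma>)" if "\<beta> \<in> F" for \<beta>
    using member_le_sum[OF that, of k] assms(1) by (simp add: less_Suc_eq_le)
  then show ?thesis
    using that[of "Suc (\<Sum>\<gamma>\<in>F. k \<gamma>)"] k unfolding node_eq_iff by (meson order_less_le_trans)
qed

text \<open>A branch outside a finite set has a node on none of its members, so the nodes determine
  the set. Thus a finite set of branches is coded by a set of nodes, hence by a single real.\<close>

lemma inj_on_branches:
  "inj_on (\<lambda>F. (\<Union>\<alpha>\<in>F. range (node \<alpha>))) {F. finite F}"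
proof -
  have "F \<subseteq> F'" if fin: "finite F'" and eq: "(\<Union>\<alpha>\<in>F. range (node \<alpha>)) = (\<Union>\<alpha>\<in>F'. range (node \<alpha>))" for F F'
  proof (rule ccontr)
    assume "\<not> F \<subseteq> F'"
    then obtain \<alpha> where \<alpha>: "\<alpha> \<in> F" "\<alpha> \<notin> F'" by blast
    obtain N where "\<And>n \<beta> m. n \<ge> N \<Longrightarrow> \<beta> \<in> F' \<Longrightarrow> node \<alpha> n \<noteq> node \<beta> m"
      using branches_separate[OF fin \<alpha>(2)] by metis
    then have "node \<alpha> N \<notin> (\<Union>\<alpha>\<in>F'. range (node \<alpha>))" by blast
    then show False using eq \<alpha>(1) by blast
  qed
  then show ?thesis unfolding inj_on_def by (metis mem_Collect_eq subset_antisym)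
qed

text \<open>In a condition \<open>(s, F)\<close> the finite set \<open>s\<close> approximates
  \<open>x\<close>, and \<open>F\<close> lists branches that may receive no further node because
  their last node is settled at a level satisfying \<open>Q\<close>. Genericity puts every branch of
  \<open>B\<close> into some \<open>F\<close> and adds arbitrarily late nodes on all branches in
  \<open>A - B\<close>.\<close>

lemma almost_disjoint_coding:
  fixes A B :: "(nat \<Rightarrow> bool) set" and \<kappa> :: "'k rel"
  assumes MA: "MA_sigma_centered TYPE(real) \<kappa>"
    and card: "|A \<times> (UNIV :: nat set)| \<le>o \<kappa>" and "B \<subseteq> A"
    and inf: "\<And>\<alpha>. \<alpha> \<in> B \<Longrightarrow> infinite {n. Q \<alpha> n}"
  obtains x where "\<And>\<alpha>. \<alpha> \<in> B \<Longrightarrow> \<exists>n. Q \<alpha> n \<and> last_node x \<alpha> n"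
    "\<And>\<alpha> n. \<alpha> \<in> A - B \<Longrightarrow> \<not> last_node x \<alpha> n"
proof -
  define P where "P = {(s, F). finite s \<and> finite F \<and> F \<subseteq> B \<and> (\<forall>\<alpha>\<in>F. \<exists>n. Q \<alpha> n \<and> last_node s \<alpha> n)}"
  define le :: "bool list set \<times> (nat \<Rightarrow> bool) set \<Rightarrow> bool list set \<times> (nat \<Rightarrow> bool) set \<Rightarrow> bool" where
    "le p q \<longleftrightarrow> fst q \<subseteq> fst p \<and> snd q \<subseteq> snd p \<and> (\<forall>\<alpha>\<in>snd q. \<forall>n. node \<alpha> n \<in> fst p \<longrightarrow> node \<alpha> n \<in> fst q)" for p q
  define D where "D = (\<lambda>(\<alpha>, N) (s, F). if \<alpha> \<in> B then \<alpha> \<in> F else \<exists>m\<ge>N. node \<alpha> m \<in> s)"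
  \<comment> \<open>An injection of the conditions into the reals, where the axiom is available; the
    tags keep the two components apart.\<close>
  define code :: "bool list set \<times> (nat \<Rightarrow> bool) set \<Rightarrow> real" where
    "code = (\<lambda>(s, F). digit_sum (Inl ` s \<union> Inr ` (\<Union>\<alpha>\<in>F. range (node \<alpha>))))"
  \<comment> \<open>Conditions are grouped by their finite set of nodes, of which there are
    countably many. Finitely many conditions of a group have a common extension with the same nodes
    and the union of their sets of branches.\<close>
  define S where "S i = {p \<in> P. fst p = set (from_nat i :: bool list list)}" for i
  \<comment> \<open>almost disjointness: a late node of a branch outside \<open>F\<close> can be added without meeting the branches in \<open>F\<close>\<close>
  have ext: "\<exists>m\<ge>N. Q' m \<and> le (insert (node \<alpha> m) s, F) (s, F) \<and> (insert (node \<alpha> m) s, F) \<in> P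
      \<and> (\<forall>k>m. node \<alpha> k \<notin> s)"
    if p: "(s, F) \<in> P" and \<alpha>: "\<alpha> \<notin> F" and Q': "infinite {m. Q' m}" for s F \<alpha> N Q'
  proof -
    have fin: "finite s" "finite F" using p by (auto simp: P_def)
    obtain N' where N': "\<And>n \<beta> m. n \<ge> N' \<Longrightarrow> \<beta> \<in> F \<Longrightarrow> node \<alpha> n \<noteq> node \<beta> m"
      using branches_separate[OF fin(2) \<alpha>] by metis
    \<comment> \<open>Such a level is late enough to miss the branches in \<open>F\<close>, and no
      node of \<open>s\<close> is longer, so the new node will be the last one of \<alpha>.\<close>
    obtain m where m: "m \<ge> N + N' + sum length s" "Q' m"
      using Q' unfolding infinite_nat_iff_unbounded_le by blast
    have "length l \<le> m" if "l \<in> s" for l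
      using member_le_sum[OF that, of length] fin m by simp
    then have "node \<alpha> k \<notin> s" if "k > m" for k using that by fastforce
    moreover have new: "node \<beta> k \<noteq> node \<alpha> m" if "\<beta> \<in> F" for \<beta> k using N'[of m \<beta> k] that m by auto
    then have "last_node (insert (node \<alpha> m) s) \<beta> n" if "last_node s \<beta> n" "\<beta> \<in> F" for \<beta> n
      using that unfolding last_node_def by auto
    then have "(insert (node \<alpha> m) s, F) \<in> P" using p unfolding P_def by blast
    moreover have "le (insert (node \<alpha> m) s, F) (s, F)" using new by (auto simp: le_def)
    ultimately show ?thesis using m by (intro exI[of _ m]) auto
  qed
  have dense: "\<exists>d\<in>P. le d p \<and> D i d" if i: "i \<in> A \<times> UNIV" and p: "p \<in> P" for i p
  proof -
    obtain \<alpha> N where i: "i = (\<alpha>, N)" "\<alpha> \<in> A" using i by blast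
    obtain s F where p: "p = (s, F)" "(s, F) \<in> P" using p by (cases p) auto
    have FB: "F \<subseteq> B" using p by (auto simp: P_def)
    consider "\<alpha> \<in> F" | "\<alpha> \<in> B" "\<alpha> \<notin> F" | "\<alpha> \<notin> B" by blast
    then show ?thesis
    proof cases
      case 1
      then show ?thesis using p i FB by (intro bexI[of _ p]) (auto simp: D_def le_def)
    next
      case 2
      obtain m where m: "Q \<alpha> m" "le (insert (node \<alpha> m) s, F) (s, F)"
        "(insert (node \<alpha> m) s, F) \<in> P" "\<forall>k>m. node \<alpha> k \<notin> s"
        using ext[OF p(2) 2(2) inf[OF 2(1)]] by blast
      have "last_node (insert (node \<alpha> m) s) \<alpha> m"
        using m(4) unfolding last_node_def by (auto simp: node_eq_iff)
      then have "(insert (node \<alpha> m) s, insert \<alpha> F) \<in> P" using m 2 unfolding P_def by auto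
      moreover have "le (insert (node \<alpha> m) s, insert \<alpha> F) p"
        using m(2) p by (auto simp: le_def)
      moreover have "D i (insert (node \<alpha> m) s, insert \<alpha> F)" using 2 i by (simp add: D_def)
      ultimately show ?thesis by blast
    next
      case 3
      then have "\<alpha> \<notin> F" using FB by blast
      from ext[OF p(2) this, of "\<lambda>_. True" N] show ?thesis
        using p i 3 unfolding D_def by fastforce
    qed
  qed
  have inj: "inj_on code P"
  proof (rule inj_onI)
    fix p q assume pq: "p \<in> P" "q \<in> P" "code p = code q"
    obtain s F s' F' where [simp]: "p = (s, F)" "q = (s', F')" by fastforce
    have *: "Inl ` s \<union> Inr ` (\<Union>\<alpha>\<in>F. range (node \<alpha>)) = Inl ` s' \<union> Inr ` (\<Union>\<alpha>\<in>F'. range (node \<alpha>))"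
      using pq(3) unfolding code_def by (simp add: inj_eq[OF inj_digit_sum])
    have parts: "Inl -` (Inl ` X \<union> Inr ` Y) = X" "Inr -` (Inl ` X \<union> Inr ` Y) = Y"
      for X Y :: "bool list set" by auto
    have "s = s'" "(\<Union>\<alpha>\<in>F. range (node \<alpha>)) = (\<Union>\<alpha>\<in>F'. range (node \<alpha>))"
      using arg_cong[OF *, of "vimage Inl"] arg_cong[OF *, of "vimage Inr"]
      unfolding parts by blast+
    moreover have "finite F" "finite F'" using pq by (auto simp: P_def)
    ultimately show "p = q" using inj_onD[OF inj_on_branches, of F F'] by simp
  qed
  have ne: "P \<noteq> {}" and PS: "P = (\<Union>i. S i)"
  proof -
    have "({}, {}) \<in> P" by (auto simp: P_def)
    then show "P \<noteq> {}" by blast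
    have "\<exists>i. p \<in> S i" if p: "p \<in> P" for p
    proof -
      have "finite (fst p)" using p by (auto simp: P_def)
      then obtain l where "fst p = set l" using finite_list by metis
      then show ?thesis using p unfolding S_def by (intro exI[of _ "to_nat l"]) simp
    qed
    then show "P = (\<Union>i. S i)" by (auto simp: S_def)
  qed
  have centered: "\<exists>q\<in>P. \<forall>p\<in>X. le q p" if X: "finite X" "X \<subseteq> S i" for i X
  proof -
    define s where "s = set (from_nat i :: bool list list)"
    have fst: "fst p = s" "p \<in> P" if "p \<in> X" for p using that X by (auto simp: S_def s_def)
    have "(s, \<Union>(snd ` X)) \<in> P"
      using fst X unfolding P_def by (fastforce simp: s_def)
    moreover have "le (s, \<Union>(snd ` X)) p" if "p \<in> X" for p
      using fst(1)[OF that] that by (auto simp: le_def)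
    ultimately show ?thesis by blast
  qed
  have refl: "le p p" for p by (simp add: le_def)
  have trans: "le p t" if "le p q" "le q t" for p q t using that unfolding le_def by blast
  have antisym: "p = q" if "le p q" "le q p" for p q
    using that unfolding le_def by (intro prod_eqI) auto
  have "\<exists>G\<subseteq>P. G \<noteq> {} \<and> (\<forall>p\<in>G. \<forall>q\<in>G. \<exists>s\<in>G. le s p \<and> le s q) \<and> (\<forall>i\<in>A \<times> UNIV. \<exists>d\<in>G. D i d)"
    by (rule MA_sigma_centered_filter[OF MA inj ne refl trans antisym PS centered card dense])
  then obtain G where G: "G \<subseteq> P"
    and dir: "\<forall>p\<in>G. \<forall>q\<in>G. \<exists>t\<in>G. le t p \<and> le t q"
    and meets: "\<forall>i\<in>A \<times> UNIV. \<exists>d\<in>G. D i d"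
    by (elim exE conjE)
  define x where "x = \<Union>(fst ` G)"
  show ?thesis
  proof (rule that[of x])
    fix \<alpha> assume \<alpha>: "\<alpha> \<in> B"
    then have "(\<alpha>, 0) \<in> A \<times> (UNIV :: nat set)" using \<open>B \<subseteq> A\<close> by blast
    then obtain p where "p \<in> G" "D (\<alpha>, 0) p" using meets by blast
    then obtain s F where sF: "(s, F) \<in> G" "\<alpha> \<in> F"
      using \<alpha> that by (cases p) (simp add: D_def)
    then have "(s, F) \<in> P" using G by blast
    then obtain n where n: "Q \<alpha> n" "last_node s \<alpha> n" using sF(2) unfolding P_def by blast
    \<comment> \<open>A common extension of \<open>(s, F)\<close> and a condition containing the
      node adds nothing on the branch \<alpha>, so the node was already in \<open>s\<close>.\<close>
    have "node \<alpha> m \<in> s" if "node \<alpha> m \<in> x" for m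
    proof -
      obtain p where p: "p \<in> G" "node \<alpha> m \<in> fst p" using \<open>node \<alpha> m \<in> x\<close> by (auto simp: x_def)
      then obtain t where "le t p" "le t (s, F)" using dir sF by blast
      then show ?thesis using p sF unfolding le_def by auto
    qed
    moreover have "s \<subseteq> x" using sF by (force simp: x_def)
    ultimately have "last_node x \<alpha> n" using n unfolding last_node_def by blast
    then show "\<exists>n. Q \<alpha> n \<and> last_node x \<alpha> n" using n by blast
  next
    fix \<alpha> n assume \<alpha>: "\<alpha> \<in> A - B"
    then have "(\<alpha>, Suc n) \<in> A \<times> (UNIV :: nat set)" by blast
    then obtain p where "p \<in> G" "D (\<alpha>, Suc n) p" using meets by blast
    then obtain m where "m \<ge> Suc n" "node \<alpha> m \<in> x"
      using \<alpha> by (cases p) (force simp: D_def x_def)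
    then show "\<not> last_node x \<alpha> n" unfolding last_node_def by (auto simp: Suc_le_eq)
  qed
qed

section \<open>Convex bodies spanned by an arc of a circle\<close>

text \<open>The half-angle formula gives at least 23/25. The bound 2/5 is the largest difference of
  two angles in \<open>{-1/5..1/5}\<close>.\<close>

lemma cos_gt_three_fifths: "cos \<theta> > 3/5" if "\<bar>\<theta>\<bar> \<le> 2/5" for \<theta> :: real
proof -
  have "\<bar>sin (\<theta> / 2)\<bar> \<le> \<bar>1/5\<bar>"
    using abs_sin_x_le_abs_x[of "\<theta> / 2"] that by simp
  then have "(sin (\<theta> / 2))\<^sup>2 \<le> (1/5)\<^sup>2" unfolding abs_le_square_iff .
  then show ?thesis using cos_double_sin[of "\<theta> / 2"] by (simp add: power2_eq_square)
qed

lemma sin_fifth_pos: "sin (1/5::real) > 0"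
  using pi_gt3 by (intro sin_gt_zero) auto

locale plane =
  fixes a b :: "'a::euclidean_space"
  assumes norm_a [simp]: "norm a = 1" and norm_b [simp]: "norm b = 1" and orth [simp]: "inner a b = 0"
begin

lemma orth' [simp]: "inner b a = 0"
  using orth by (simp add: inner_commute)

lemma inner_ab [simp]: "inner a a = 1" "inner b b = 1"
  using norm_a norm_b unfolding norm_eq_1 by blast+

definition circ :: "real \<Rightarrow> 'a" where
  "circ \<theta> = cos \<theta> *\<^sub>R a + sin \<theta> *\<^sub>R b"

lemma inner_circ: "inner (circ \<theta>) (circ \<phi>) = cos (\<theta> - \<phi>)"
  by (simp add: circ_def inner_add_left inner_add_right cos_diff)

lemma norm_circ [simp]: "norm (circ \<theta>) = 1"
  by (simp add: norm_eq_1 inner_circ)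

lemma circ_inj:
  assumes "circ \<theta> = circ \<phi>" "\<bar>\<theta>\<bar> \<le> 1" "\<bar>\<phi>\<bar> \<le> 1"
  shows "\<theta> = \<phi>"
proof -
  have "inner b (circ \<theta>) = inner b (circ \<phi>)" using assms(1) by simp
  then have "sin \<theta> = sin \<phi>" by (simp add: circ_def inner_add_right)
  then show ?thesis
    using assms(2,3) pi_gt3 sin_inj_pi[of \<theta> \<phi>] by (simp add: abs_le_iff)
qed

text \<open>A unit vector lies in no open segment of the unit ball, so it is an extreme point of any
  hull inside the ball that contains it, and extreme points of a hull belong to the generating
  set.\<close>

lemma circ_in_hull_iff:
  assumes F: "F \<subseteq> {-1..1}" and \<theta>: "\<bar>\<theta>\<bar> \<le> 1"
  shows "circ \<theta> \<in> convex hull (circ ` F) \<longleftrightarrow> \<theta> \<in> F"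
proof
  assume h: "circ \<theta> \<in> convex hull (circ ` F)"
  have sub: "convex hull (circ ` F) \<subseteq> cball 0 1"
    by (rule hull_minimal) auto
  have "circ \<theta> \<notin> open_segment x y" if xy: "x \<in> cball 0 1" "y \<in> cball 0 1" for x y :: 'a
  proof
    assume "circ \<theta> \<in> open_segment x y"
    then show False using dist_decreases_open_segment[of "circ \<theta>" x y 0] xy by auto
  qed
  then have "circ \<theta> extreme_point_of (convex hull (circ ` F))"
    using h sub unfolding extreme_point_of_def by blast
  then have "circ \<theta> \<in> circ ` F" by (rule extreme_point_of_convex_hull)
  then obtain \<phi> where "\<phi> \<in> F" "circ \<theta> = circ \<phi>" by blast
  moreover have "\<phi> \<in> {-1..1}" using F \<open>\<phi> \<in> F\<close> by blast
  then have "\<bar>\<phi>\<bar> \<le> 1" by (simp add: abs_le_iff)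
  ultimately show "\<theta> \<in> F" using circ_inj[OF _ \<theta>] by simp
next
  assume "\<theta> \<in> F"
  then show "circ \<theta> \<in> convex hull (circ ` F)" by (rule hull_inc[OF imageI])
qed

text \<open>Orthogonal projection onto the plane of \<open>a\<close> and \<open>b\<close>, followed
  by the rotation by \<open>- t\<close>. It is defined and linear on the whole space but isometric
  only on the plane, which contains all the bodies to be rotated.\<close>

definition rot :: "real \<Rightarrow> 'a \<Rightarrow> 'a" where
  "rot t x = (cos t * inner a x + sin t * inner b x) *\<^sub>R a + (cos t * inner b x - sin t * inner a x) *\<^sub>R b"

lemma linear_rot: "linear (rot t)"
proof (rule linearI)
  fix x y c
  have "(cos t * (p + q) + sin t * (p' + q')) *\<^sub>R a + (cos t * (p' + q') - sin t * (p + q)) *\<^sub>R b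
      = (cos t * p + sin t * p') *\<^sub>R a + (cos t * p' - sin t * p) *\<^sub>R b
        + ((cos t * q + sin t * q') *\<^sub>R a + (cos t * q' - sin t * q) *\<^sub>R b)" for p q p' q'
    by (simp add: scaleR_add_left scaleR_diff_left distrib_left)
  then show "rot t (x + y) = rot t x + rot t y"
    unfolding rot_def inner_add_right by blast
  have "(cos t * (c * p) + sin t * (c * q)) *\<^sub>R a + (cos t * (c * q) - sin t * (c * p)) *\<^sub>R b
      = c *\<^sub>R ((cos t * p + sin t * q) *\<^sub>R a + (cos t * q - sin t * p) *\<^sub>R b)" for p q
    by (simp add: scaleR_add_right right_diff_distrib distrib_left mult.left_commute)
  then show "rot t (c *\<^sub>R x) = c *\<^sub>R rot t x"
    unfolding rot_def inner_scaleR_right by blast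
qed

lemma rot_circ: "rot t (circ \<theta>) = circ (\<theta> - t)"
proof -
  have "inner a (circ \<theta>) = cos \<theta>" "inner b (circ \<theta>) = sin \<theta>"
    by (simp_all add: circ_def inner_add_right)
  moreover have "cos t * cos \<theta> + sin t * sin \<theta> = cos (\<theta> - t)"
    "cos t * sin \<theta> - sin t * cos \<theta> = sin (\<theta> - t)"
    by (simp_all add: cos_diff sin_diff mult.commute)
  ultimately show ?thesis by (simp add: rot_def circ_def)
qed

text \<open>The assumption says that \<open>z\<close> equals its projection onto the plane spanned
  by \<open>a\<close> and \<open>b\<close>.\<close>

lemma norm_rot:
  assumes "inner a z *\<^sub>R a + inner b z *\<^sub>R b = z"
  shows "norm (rot t z) = norm z"
proof -
  have n: "(norm (x *\<^sub>R a + y *\<^sub>R b))\<^sup>2 = x\<^sup>2 + y\<^sup>2" for x y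
    unfolding power2_norm_eq_inner by (simp add: inner_add_left inner_add_right power2_eq_square)
  have "(norm (rot t z))\<^sup>2 = (sin t ^ 2 + cos t ^ 2) * ((inner a z)\<^sup>2 + (inner b z)\<^sup>2)"
  proof -
    have "(c * p + s * q)\<^sup>2 + (c * q - s * p)\<^sup>2 = (s\<^sup>2 + c\<^sup>2) * (p\<^sup>2 + q\<^sup>2)" for c s p q :: real
      by algebra
    then show ?thesis unfolding rot_def n .
  qed
  also have "\<dots> = (norm z)\<^sup>2"
    using n[of "inner a z" "inner b z"] assms by simp
  finally show ?thesis by simp
qed

lemma isometric_copy_rotated:
  "isometric_copy (convex hull (circ ` E)) (convex hull (circ ` ((\<lambda>\<theta>. \<theta> - t) ` E)))"
  unfolding isometric_copy_def
proof (intro exI[of _ "rot t"] conjI ballI)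
  let ?W = "{z. inner a z *\<^sub>R a + inner b z *\<^sub>R b = z}"
  have W: "subspace ?W"
  proof (rule subspaceI)
    fix x y assume x: "x \<in> ?W" and y: "y \<in> ?W"
    have "inner a (x + y) *\<^sub>R a + inner b (x + y) *\<^sub>R b
        = (inner a x *\<^sub>R a + inner b x *\<^sub>R b) + (inner a y *\<^sub>R a + inner b y *\<^sub>R b)"
      by (simp add: inner_add_right scaleR_add_left)
    then show "x + y \<in> ?W" using x y by simp
  next
    fix c x assume x: "x \<in> ?W"
    have "inner a (c *\<^sub>R x) *\<^sub>R a + inner b (c *\<^sub>R x) *\<^sub>R b
        = c *\<^sub>R (inner a x *\<^sub>R a + inner b x *\<^sub>R b)"
      by (simp add: scaleR_add_right)
    then show "c *\<^sub>R x \<in> ?W" using x by simp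
  qed simp
  have "convex hull (circ ` E) \<subseteq> ?W"
  proof (rule hull_minimal)
    show "circ ` E \<subseteq> ?W" by (auto simp: circ_def inner_add_right)
    show "convex ?W" using W by (rule subspace_imp_convex)
  qed
  moreover fix x y assume "x \<in> convex hull (circ ` E)" "y \<in> convex hull (circ ` E)"
  ultimately have "x - y \<in> ?W" using subspace_diff[OF W] by blast
  then show "dist (rot t x) (rot t y) = dist x y"
    using norm_rot[of "x - y" t] by (simp add: dist_norm linear_diff[OF linear_rot])
next
  show "rot t ` (convex hull (circ ` E)) = convex hull (circ ` ((\<lambda>\<theta>. \<theta> - t) ` E))"
    unfolding convex_hull_linear_image[OF linear_rot] image_image rot_circ ..
qed

text \<open>The line through \<open>circ (1/5)\<close> and \<open>circ (-1/5)\<close>, which are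
  reached at \<tau> equal to \<open>sin (1/5)\<close> and \<open>- sin (1/5)\<close>.\<close>

definition chord :: "real \<Rightarrow> 'a" where
  "chord \<tau> = cos (1/5) *\<^sub>R a + \<tau> *\<^sub>R b"

section \<open>Position of a body relative to the unit ball\<close>

context
  fixes E :: "real set"
  assumes E: "E \<subseteq> {-1/5..1/5}" "1/5 \<in> E" "-1/5 \<in> E"
begin

abbreviation "body \<equiv> convex hull (circ ` E)"

lemma chord_in_body:
  assumes "0 \<le> \<tau>" "\<tau> \<le> sin (1/5)"
  shows "chord \<tau> \<in> body"
proof -
  let ?s = "sin (1/5::real)"
  have "chord \<tau> = ((?s + \<tau>) / (2 * ?s)) *\<^sub>R circ (1/5) + ((?s - \<tau>) / (2 * ?s)) *\<^sub>R circ (-1/5)"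
  proof -
    define l m where "l = (?s + \<tau>) / (2 * ?s)" and "m = (?s - \<tau>) / (2 * ?s)"
    have lm: "l + m = 1" "l * ?s - m * ?s = \<tau>"
      using sin_fifth_pos by (simp_all add: l_def m_def field_simps)
    have "l *\<^sub>R circ (1/5) + m *\<^sub>R circ (-1/5) = ((l + m) * cos (1/5)) *\<^sub>R a + (l * ?s - m * ?s) *\<^sub>R b"
      by (simp add: circ_def algebra_simps)
    then show ?thesis unfolding lm chord_def mult_1 unfolding l_def m_def by (rule sym)
  qed
  moreover have "(?s + \<tau>) / (2 * ?s) + (?s - \<tau>) / (2 * ?s) = 1"
    using sin_fifth_pos by (simp add: field_simps)
  ultimately show ?thesis
    using convexD[OF convex_convex_hull, of "circ (1/5)" "circ ` E" "circ (-1/5)"] assms sin_fifth_pos E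
    by (simp add: hull_inc)
qed

lemma body_half_space: "x \<in> body \<Longrightarrow> cos (1/5) \<le> inner a x"
proof -
  have "body \<subseteq> {x. inner a x \<ge> cos (1/5)}"
  proof (rule hull_minimal)
    show "circ ` E \<subseteq> {x. inner a x \<ge> cos (1/5)}"
    proof safe
      fix \<theta> assume "\<theta> \<in> E"
      then have "\<theta> \<in> {-1/5..1/5}" using E by blast
      then have "\<bar>\<theta>\<bar> \<le> 1/5" by (auto simp: abs_le_iff)
      then have "cos (1/5) \<le> cos \<bar>\<theta>\<bar>" using pi_gt3 by (intro cos_monotone_0_pi_le) auto
      then show "inner a (circ \<theta>) \<ge> cos (1/5)" by (simp add: circ_def inner_add_right)
    qed
  qed (rule convex_halfspace_ge)
  then show "x \<in> body \<Longrightarrow> cos (1/5) \<le> inner a x" by auto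
qed

text \<open>All angles of the arc are within 2/5 of the corner \<open>circ (1/5)\<close>. Hence
  moving the body against the direction of this corner pushes all of it into the open ball.\<close>

lemma body_cap: "x \<in> body \<Longrightarrow> 3/5 \<le> inner (circ (1/5)) x"
proof -
  have "body \<subseteq> {x. inner (circ (1/5)) x \<ge> 3/5}"
  proof (rule hull_minimal)
    show "circ ` E \<subseteq> {x. inner (circ (1/5)) x \<ge> 3/5}"
    proof safe
      fix \<theta> assume "\<theta> \<in> E"
      then have "\<bar>1/5 - \<theta>\<bar> \<le> 2/5" using E by (auto simp: abs_le_iff)
      then show "inner (circ (1/5)) (circ \<theta>) \<ge> 3/5"
        unfolding inner_circ using cos_gt_three_fifths less_imp_le by blast
    qed
  qed (rule convex_halfspace_ge)
  then show "x \<in> body \<Longrightarrow> 3/5 \<le> inner (circ (1/5)) x" by auto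
qed

lemma body_ball: "x \<in> body \<Longrightarrow> norm x \<le> 1"
proof -
  have "body \<subseteq> cball 0 1" by (rule hull_minimal) auto
  then show "x \<in> body \<Longrightarrow> norm x \<le> 1" by auto
qed

text \<open>The edge of the body lies on the supporting hyperplane through \<open>chord \<tau>\<close> with normal \<open>a\<close>.\<close>
lemma outer_copy:
  assumes f: "orthogonal_transformation f" and p: "norm p \<ge> 1" "p = norm p *\<^sub>R f a"
    and x: "x \<in> body" and 1: "norm (p + f (x - chord \<tau>)) = 1"
  shows "p + f (x - chord \<tau>) = p"
proof -
  define y where "y = p + f (x - chord \<tau>)"
  have fa: "norm (f a) = 1" using f by (simp add: orthogonal_transformation_norm)
  have "inner (f a) p = norm p" using p(2) fa by (metis inner_scaleR_right mult.right_neutral norm_eq_1)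
  moreover have "inner (f a) (f (x - chord \<tau>)) = inner a x - cos (1/5)"
    using f by (simp add: orthogonal_transformation_def inner_diff_right chord_def inner_add_right)
  ultimately have ge: "inner (f a) y \<ge> norm p"
    using body_half_space[OF x] by (simp add: y_def inner_add_right)
  have "inner y y = 1" "inner (f a) (f a) = 1" using 1 fa unfolding y_def norm_eq_1 by blast+
  \<comment> \<open>Since \<open>inner (f a) y\<close> is at least \<open>norm p\<close>, hence at
    least 1, the right side is not positive. This forces \<open>y = f a\<close> and
    \<open>norm p = 1\<close>, so \<open>y = p\<close>.\<close>
  then have "(norm (y - f a))\<^sup>2 = 2 - 2 * inner (f a) y"
    unfolding power2_norm_eq_inner inner_diff_left inner_diff_right by (simp add: inner_commute)
  moreover have "(norm (y - f a))\<^sup>2 \<ge> 0" by simp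
  ultimately have "norm p = 1" "(norm (y - f a))\<^sup>2 = 0" using ge p(1) by linarith+
  then show ?thesis using p(2) by (simp add: y_def)
qed

text \<open>With its corner placed at \<open>p\<close>, the body is a rotated copy shifted inwards
  by \<open>s = 1 - norm p\<close>. The cap estimate bounds the squared norms by
  \<open>1 - 6 * s / 5 + s\<^sup>2\<close>, hence by \<open>1 - s / 5\<close>. What remains up to
  radius 1 leaves room to slide along the edge.\<close>

lemma inner_copy:
  assumes f: "orthogonal_transformation f" and p: "norm p < 1" "p = norm p *\<^sub>R f (circ (1/5))"
    and x: "x \<in> body" and \<tau>: "\<bar>sin (1/5) - \<tau>\<bar> < 1 - sqrt (1 - (1 - norm p) / 5)"
  shows "norm (p + f (x - chord \<tau>)) < 1"
proof -
  define s where "s = 1 - norm p"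
  let ?w = "circ (1/5)"
  have s: "0 < s" "s \<le> 1" using p by (auto simp: s_def)
  have lin: "linear f" using f by (simp add: orthogonal_transformation_def)
  have "p + f (x - chord \<tau>) = f (norm p *\<^sub>R ?w + (x - chord \<tau>))"
    using p(2) by (simp add: linear_add[OF lin] linear_scale[OF lin])
  also have "norm p *\<^sub>R ?w + (x - chord \<tau>) = (x - s *\<^sub>R ?w) + (sin (1/5) - \<tau>) *\<^sub>R b"
    by (simp add: s_def chord_def circ_def algebra_simps)
  finally have "norm (p + f (x - chord \<tau>)) = norm ((x - s *\<^sub>R ?w) + (sin (1/5) - \<tau>) *\<^sub>R b)"
    using f by (simp add: orthogonal_transformation_norm)
  also have "\<dots> \<le> norm (x - s *\<^sub>R ?w) + \<bar>sin (1/5) - \<tau>\<bar>"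
    using norm_triangle_ineq[of "x - s *\<^sub>R ?w" "(sin (1/5) - \<tau>) *\<^sub>R b"] by simp
  also have "norm (x - s *\<^sub>R ?w) \<le> sqrt (1 - s / 5)"
  proof (rule real_le_rsqrt)
    have "(norm (x - s *\<^sub>R ?w))\<^sup>2 = (norm x)\<^sup>2 - 2 * s * inner ?w x + s\<^sup>2 * (norm ?w)\<^sup>2"
    proof -
      have "inner (x - s *\<^sub>R w) (x - s *\<^sub>R w) = inner x x - 2 * s * inner w x + s\<^sup>2 * inner w w" for w
        unfolding inner_diff_left inner_diff_right inner_scaleR_left inner_scaleR_right inner_commute[of x w]
        by algebra
      then show ?thesis unfolding power2_norm_eq_inner .
    qed
    also have "\<dots> \<le> 1 - 2 * s * (3/5) + s"
    proof -
      have "(norm x)\<^sup>2 \<le> 1" using body_ball[OF x] by (simp add: power_le_one)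
      moreover have "2 * s * (3/5) \<le> 2 * s * inner ?w x"
        using body_cap[OF x] s by (intro mult_left_mono) auto
      moreover have "s\<^sup>2 \<le> s" using s by (simp add: power2_eq_square mult_left_le)
      ultimately show ?thesis by simp
    qed
    finally show "(norm (x - s *\<^sub>R ?w))\<^sup>2 \<le> 1 - s / 5" by simp
  qed
  finally show ?thesis using \<tau> by (simp add: s_def)
qed

end

end

text \<open>At a point where \<open>inner d\<close> is maximal on \<open>S\<close>, translation by
  \<open>d\<close> would raise the value by \<open>inner d d\<close>.\<close>

lemma compact_translation_eq_imp_zero:
  fixes S :: "'a::euclidean_space set"
  assumes "compact S" "S \<noteq> {}" "(\<lambda>x. x + d) ` S = S"
  shows "d = 0"
proof -
  obtain x where x: "x \<in> S" "\<And>y. y \<in> S \<Longrightarrow> inner d y \<le> inner d x"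
    using continuous_attains_sup[OF assms(1,2), of "inner d"] by (meson bounded_linear_inner_right linear_continuous_on)
  have "x + d \<in> S" using x(1) assms(3) by blast
  from x(2)[OF this] have "inner d d \<le> 0" by (simp add: inner_add_right)
  then show ?thesis by (metis inner_eq_zero_iff inner_ge_zero order_antisym)
qed

lemma isometric_copy_compact:
  assumes "compact S" "isometric_copy S T"
  shows "compact T"
proof -
  obtain f where f: "\<And>x y. x \<in> S \<Longrightarrow> y \<in> S \<Longrightarrow> dist (f x) (f y) = dist x y" "f ` S = T"
    using assms(2) unfolding isometric_copy_def by blast
  have "continuous_on S f" unfolding continuous_on_iff using f(1) by metis
  then show ?thesis using compact_continuous_image assms(1) f(2) by blast
qed

text \<open>The body is placed so that \<open>p\<close> is a point of its edge, and then slid along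
  that edge. For \<open>norm p < 1\<close> the copies stay in the open ball; otherwise they lie
  beyond a hyperplane through \<open>p\<close> that meets the closed ball at most in
  \<open>p\<close>.\<close>

lemma many_copies:
  fixes a b :: "real ^ 'n" and E :: "real set"
  assumes ab: "plane a b" and E: "E \<subseteq> {-1/5..1/5}" "1/5 \<in> E" "-1/5 \<in> E" "compact E"
  obtains Z :: "real \<Rightarrow> (real ^ 'n) set" where "inj_on Z {0..1}"
    "\<And>s. s \<in> {0..1} \<Longrightarrow> p \<in> Z s \<and> isometric_copy (convex hull (plane.circ a b ` E)) (Z s) \<and>
      (\<forall>y\<in>Z s. norm y = 1 \<longrightarrow> y = p)"
proof -
  interpret plane a b by fact
  let ?C = "convex hull (circ ` E)"
  have C: "compact ?C" "?C \<noteq> {}"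
    using E by (auto intro!: compact_convex_hull compact_continuous_image continuous_intros simp: circ_def[abs_def])
  have "\<exists>f \<epsilon>. orthogonal_transformation f \<and> 0 < \<epsilon> \<and> \<epsilon> \<le> sin (1/5) \<and>
     (\<forall>s\<in>{0..1}. \<forall>x\<in>?C. norm (p + f (x - chord (sin (1/5) - \<epsilon> * s))) = 1 \<longrightarrow>
       p + f (x - chord (sin (1/5) - \<epsilon> * s)) = p)"
  proof -
    obtain q where q: "norm q = 1" "p = norm p *\<^sub>R q"
    proof (cases "p = 0")
      case True then show ?thesis using that[of a] by simp
    next
      case False then show ?thesis using that[of "p /\<^sub>R norm p"] by simp
    qed
    show ?thesis
    proof (cases "norm p < 1")
      case True
      obtain f where f: "orthogonal_transformation f" "f (circ (1/5)) = q"
        using orthogonal_transformation_exists_1[of "circ (1/5)" q] q by auto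
      define r where "r = (1 - sqrt (1 - (1 - norm p) / 5))"
      have "sqrt (1 - (1 - norm p) / 5) < 1" using True by (subst real_sqrt_lt_1_iff) auto
      then have "r > 0" by (simp add: r_def)
      \<comment> \<open>The first bound keeps the point at \<open>p\<close> on the half of the edge
        with nonnegative \<tau>, the second keeps the slide strictly below the room
        \<open>r\<close>.\<close>
      define \<epsilon> where "\<epsilon> = min (sin (1/5)) (r / 2)"
      have \<epsilon>: "0 < \<epsilon>" "\<epsilon> \<le> sin (1/5)" "\<epsilon> < r"
        using \<open>r > 0\<close> sin_fifth_pos by (auto simp: \<epsilon>_def min_def)
      have "norm (p + f (x - chord (sin (1/5) - \<epsilon> * s))) < 1" if "s \<in> {0..1}" "x \<in> ?C" for s x
      proof (rule inner_copy[OF E(1-3) f(1) True _ that(2)])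
        show "p = norm p *\<^sub>R f (circ (1/5))" using q f by simp
        have "\<epsilon> * s \<le> \<epsilon>" "0 \<le> \<epsilon> * s" using \<epsilon> that by (auto simp: mult_left_le)
        then show "\<bar>sin (1/5) - (sin (1/5) - \<epsilon> * s)\<bar> < 1 - sqrt (1 - (1 - norm p) / 5)"
          using \<epsilon>(3) unfolding r_def by linarith
      qed
      then show ?thesis using f \<epsilon> by (intro exI[of _ f] exI[of _ \<epsilon>]) fastforce
    next
      case False
      obtain f where f: "orthogonal_transformation f" "f a = q"
        using orthogonal_transformation_exists_1[of a q] q by auto
      have "p + f (x - chord (sin (1/5) - sin (1/5) * s)) = p"
        if "x \<in> ?C" "norm (p + f (x - chord (sin (1/5) - sin (1/5) * s))) = 1" for s x
        using outer_copy[OF E(1-3) f(1) _ _ that] False q(2) f(2) by simp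
      then show ?thesis
        using f sin_fifth_pos by (intro exI[of _ f] exI[of _ "sin (1/5)"]) simp
    qed
  qed
  then obtain f \<epsilon> where f: "orthogonal_transformation f" and \<epsilon>: "0 < \<epsilon>" "\<epsilon> \<le> sin (1/5)"
    and copy: "\<And>s x. s\<in>{0..1} \<Longrightarrow> x \<in> ?C \<Longrightarrow> norm (p + f (x - chord (sin (1/5) - \<epsilon> * s))) = 1 \<Longrightarrow>
       p + f (x - chord (sin (1/5) - \<epsilon> * s)) = p" by blast
  have lin: "linear f" using f by (simp add: orthogonal_transformation_def)
  define Z where "Z s = (\<lambda>x. p + f (x - chord (sin (1/5) - \<epsilon> * s))) ` ?C" for s
  \<comment> \<open>The copies are translates of each other along the edge, so compactness makes
    them distinct.\<close>
  have shift: "Z s = (\<lambda>y. y + (\<epsilon> * (s - t)) *\<^sub>R f b) ` Z t" for s t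
  proof -
    have "x - chord (sin (1/5) - \<epsilon> * s) = x - chord (sin (1/5) - \<epsilon> * t) + (\<epsilon> * (s - t)) *\<^sub>R b" for x
      by (simp add: chord_def algebra_simps)
    then have "p + f (x - chord (sin (1/5) - \<epsilon> * s)) =
        p + f (x - chord (sin (1/5) - \<epsilon> * t)) + (\<epsilon> * (s - t)) *\<^sub>R f b" for x
      by (metis add.assoc linear_add[OF lin] linear_scale[OF lin])
    then show ?thesis unfolding Z_def image_image by presburger
  qed
  have compactZ: "compact (Z s)" "Z s \<noteq> {}" for s
    unfolding Z_def using C lin
    by (auto intro!: compact_continuous_image continuous_intros linear_continuous_on_compose[of _ _ f])
  show ?thesis
  proof (rule that[of Z])
    show "inj_on Z {0..1}"
    proof (rule inj_onI)
      fix s t assume "Z s = Z t"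
      then have "(\<epsilon> * (s - t)) *\<^sub>R f b = 0"
        using shift[of s t] compactZ[of t] by (intro compact_translation_eq_imp_zero[of "Z t"]) auto
      moreover have "norm (f b) = 1" using f by (simp add: orthogonal_transformation_norm)
      ultimately show "s = t" using \<epsilon> by auto
    qed
    fix s :: real assume s: "s \<in> {0..1}"
    then have es: "\<epsilon> * s \<le> \<epsilon>" "0 \<le> \<epsilon> * s" using \<epsilon> by (auto simp: mult_left_le)
    then have "chord (sin (1/5) - \<epsilon> * s) \<in> ?C"
      using \<epsilon>(2) by (intro chord_in_body[OF E(1-3)]) linarith+
    then have "p \<in> Z s" unfolding Z_def using linear_0[OF lin] by force
    have "dist (p + f (x - c)) (p + f (y - c)) = dist x y" for x y c
    proof -
      have "dist (p + f (x - c)) (p + f (y - c)) = norm (f (x - c - (y - c)))"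
        unfolding linear_diff[OF lin, of "x - c"] by (simp add: dist_norm)
      also have "\<dots> = dist x y"
        using orthogonal_transformation_norm[OF f] by (simp add: dist_norm)
      finally show ?thesis .
    qed
    then have "isometric_copy ?C (Z s)" unfolding isometric_copy_def Z_def
      by (intro exI[of _ "\<lambda>x. p + f (x - chord (sin (1/5) - \<epsilon> * s))"] conjI ballI refl)
    with \<open>p \<in> Z s\<close> show "p \<in> Z s \<and> isometric_copy ?C (Z s) \<and> (\<forall>y\<in>Z s. norm y = 1 \<longrightarrow> y = p)"
      using copy[OF s] unfolding Z_def by auto
  qed
qed

section \<open>The set of angles and the cover\<close>

text \<open>The three summands of the type hold the bits of the branch, the level, and the nodes of
  a node set.\<close>

definition index_code :: "(nat \<Rightarrow> bool) \<Rightarrow> nat \<Rightarrow> (nat + nat + bool list) set" where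
  "index_code \<alpha> n = insert (Inr (Inl n)) (Inl ` {i. \<alpha> i})"

definition point_code :: "bool list set \<Rightarrow> (nat + nat + bool list) set" where
  "point_code x = (\<lambda>l. Inr (Inr l)) ` x"

text \<open>
  The two extra angles give the convex hull of the arc an edge; as \<open>1/5\<close> and \<open>-1/5\<close> are far from
  \<open>{0..1/15}\<close>, they never interfere with the coding.
\<close>
definition code_angles :: "real set" where
  "code_angles = closure {digit_sum (index_code \<alpha> n \<union> point_code x) | \<alpha> n x. last_node x \<alpha> n} \<union> {-1/5, 1/5}"

lemma mem_codes:
  "Inl i \<in> index_code \<alpha> n \<union> point_code x \<longleftrightarrow> \<alpha> i"
  "Inr (Inl m) \<in> index_code \<alpha> n \<union> point_code x \<longleftrightarrow> m = n"
  "Inr (Inr l) \<in> index_code \<alpha> n \<union> point_code x \<longleftrightarrow> l \<in> x"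
  by (auto simp: index_code_def point_code_def)

lemma digit_sum_codes:
  "digit_sum (index_code \<alpha> n \<union> point_code x) = digit_sum (index_code \<alpha> n) + digit_sum (point_code x)"
  by (rule digit_sum_Un) (auto simp: index_code_def point_code_def)

lemma closure_codes:
  "closure {digit_sum (index_code \<alpha> n \<union> point_code x) | \<alpha> n x. last_node x \<alpha> n} \<subseteq> {0..1/15}"
proof (rule closure_minimal)
  show "{digit_sum (index_code \<alpha> n \<union> point_code x) | \<alpha> n x. last_node x \<alpha> n} \<subseteq> {0..1/15}"
    unfolding subset_iff atLeastAtMost_iff using digit_sum_bounds by blast
qed simp

lemma code_angles:
  shows "code_angles \<subseteq> {-1/5..1/5}" and "1/5 \<in> code_angles" and "-1/5 \<in> code_angles"
    and "compact code_angles"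
proof -
  have "closure {digit_sum (index_code \<alpha> n \<union> point_code x) | \<alpha> n x. last_node x \<alpha> n} \<subseteq> {-1/5..1/5}"
    using closure_codes by (rule order_trans) auto
  then show *: "code_angles \<subseteq> {-1/5..1/5}" unfolding code_angles_def by simp
  show "1/5 \<in> code_angles" "-1/5 \<in> code_angles" by (simp_all add: code_angles_def)
  have "closed code_angles" unfolding code_angles_def by (intro closed_Un) auto
  then show "compact code_angles"
    using * bounded_subset[OF bounded_closed_interval] by (auto simp: compact_eq_bounded_closed)
qed

text \<open>Taking the closure adds no wrong pair. For each level \<open>m\<close> from
  \<open>n\<close> on, whether node \<open>m\<close> of \<alpha> behaves as required depends on
  finitely many digits, and an honest code sharing these digits gives the right answer.\<close>

lemma mem_code_angles_iff:
  "digit_sum (point_code x) + digit_sum (index_code \<alpha> n) \<in> code_angles \<longleftrightarrow> last_node x \<alpha> n"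
proof
  define U where "U = {index_code \<alpha> n \<union> point_code x | \<alpha> n x. last_node x \<alpha> n}"
  have U: "{digit_sum (index_code \<alpha> n \<union> point_code x) | \<alpha> n x. last_node x \<alpha> n} = digit_sum ` U"
    unfolding U_def by blast
  assume "digit_sum (point_code x) + digit_sum (index_code \<alpha> n) \<in> code_angles"
  then have "digit_sum (index_code \<alpha> n \<union> point_code x) \<in> code_angles"
    by (simp add: digit_sum_codes add.commute)
  moreover have "digit_sum (index_code \<alpha> n \<union> point_code x) \<notin> {-1/5, 1/5}"
    using digit_sum_bounds[of "index_code \<alpha> n \<union> point_code x"] by auto
  ultimately have cl: "digit_sum (index_code \<alpha> n \<union> point_code x) \<in> closure (digit_sum ` U)"
    unfolding code_angles_def U by simp
  have "node \<alpha> m \<in> x \<longleftrightarrow> m = n" if "n \<le> m" for m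
  proof -
    \<comment> \<open>The places for the level, for membership of the node in \<open>x\<close>, and
      for the bits that determine the node.\<close>
    let ?I = "insert (Inr (Inl n)) (insert (Inr (Inr (node \<alpha> m))) (Inl ` {..<m})) :: (nat + nat + bool list) set"
    obtain w where w: "w \<in> U" "w \<inter> ?I = (index_code \<alpha> n \<union> point_code x) \<inter> ?I"
      by (rule digit_sum_closure[OF cl, of ?I]) simp
    then obtain \<alpha>' n' x' where w': "w = index_code \<alpha>' n' \<union> point_code x'" "last_node x' \<alpha>' n'"
      unfolding U_def by blast
    have iff: "k \<in> index_code \<alpha>' n' \<union> point_code x' \<longleftrightarrow> k \<in> index_code \<alpha> n \<union> point_code x" if "k \<in> ?I" for k
      using w(2) that unfolding w'(1) by (metis IntE IntI)
    have "\<alpha>' i \<longleftrightarrow> \<alpha> i" if "i < m" for i using iff[of "Inl i"] that unfolding mem_codes by simp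
    then have "node \<alpha>' m = node \<alpha> m" by (simp add: node_eq_iff)
    moreover have "n' = n" using iff[of "Inr (Inl n)"] unfolding mem_codes by simp
    moreover have "node \<alpha> m \<in> x' \<longleftrightarrow> node \<alpha> m \<in> x"
      using iff[of "Inr (Inr (node \<alpha> m))"] unfolding mem_codes by simp
    moreover have "node \<alpha>' m \<in> x' \<longleftrightarrow> m = n'"
      using w'(2) that \<open>n' = n\<close> unfolding last_node_def by (cases "m = n'") auto
    ultimately show ?thesis by simp
  qed
  from this[of n] this show "last_node x \<alpha> n" unfolding last_node_def by simp
next
  assume "last_node x \<alpha> n"
  then have "digit_sum (index_code \<alpha> n \<union> point_code x) \<in> code_angles"
    unfolding code_angles_def by (intro UnI1 subsetD[OF closure_subset]) blast
  then show "digit_sum (point_code x) + digit_sum (index_code \<alpha> n) \<in> code_angles"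
    by (simp add: digit_sum_codes add.commute)
qed

lemma inj_index_code: "digit_sum (index_code \<alpha> n) = digit_sum (index_code \<beta> m) \<longleftrightarrow> \<alpha> = \<beta> \<and> n = m"
proof
  assume "digit_sum (index_code \<alpha> n) = digit_sum (index_code \<beta> m)"
  \<comment> \<open>The empty point code brings both sides into the form treated by
    \<open>mem_codes\<close>.\<close>
  then have eq: "index_code \<alpha> n \<union> point_code {} = index_code \<beta> m \<union> point_code {}"
    by (simp add: inj_eq[OF inj_digit_sum])
  have "\<alpha> i \<longleftrightarrow> \<beta> i" for i
    using mem_codes(1)[of i \<alpha> n "{}"] mem_codes(1)[of i \<beta> m "{}"] unfolding eq by simp
  moreover have "n = m"
    using mem_codes(2)[of n \<alpha> n "{}"] mem_codes(2)[of n \<beta> m "{}"] unfolding eq by simp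
  ultimately show "\<alpha> = \<beta> \<and> n = m" by auto
qed auto

section \<open>Rotated copies indexed by branches and levels\<close>

context plane
begin

definition copy :: "(nat \<Rightarrow> bool) \<Rightarrow> nat \<Rightarrow> 'a set" where
  "copy \<alpha> n = convex hull (circ ` ((\<lambda>\<theta>. \<theta> - digit_sum (index_code \<alpha> n)) ` code_angles))"

lemma circ_in_copy_iff:
  assumes "\<bar>\<theta>\<bar> \<le> 1"
  shows "circ \<theta> \<in> copy \<alpha> n \<longleftrightarrow> \<theta> + digit_sum (index_code \<alpha> n) \<in> code_angles"
proof -
  define t where "t = digit_sum (index_code \<alpha> n)"
  have t: "0 \<le> t" "t \<le> 1/15" unfolding t_def by (rule digit_sum_bounds)+
  have "(\<lambda>\<theta>. \<theta> - t) ` code_angles \<subseteq> (\<lambda>\<theta>. \<theta> - t) ` {-1/5..1/5}" using code_angles(1) by blast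
  also have "\<dots> \<subseteq> {-1..1}" using t by auto
  finally have "circ \<theta> \<in> copy \<alpha> n \<longleftrightarrow> \<theta> \<in> (\<lambda>\<theta>. \<theta> - t) ` code_angles"
    unfolding copy_def t_def[symmetric] by (rule circ_in_hull_iff[OF _ assms])
  also have "\<dots> \<longleftrightarrow> \<theta> + t \<in> code_angles"
    by (auto simp: image_iff intro!: bexI[of _ "\<theta> + t"])
  finally show ?thesis unfolding t_def .
qed

lemma circ_in_copy: "circ (digit_sum (point_code x)) \<in> copy \<alpha> n \<longleftrightarrow> last_node x \<alpha> n"
proof -
  have "\<bar>digit_sum (point_code x)\<bar> \<le> 1"
    using digit_sum_bounds[of "point_code x"] by linarith
  then show ?thesis by (simp add: circ_in_copy_iff mem_code_angles_iff)
qed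

text \<open>The largest angle of the rotated arc is 1/5 minus the rotation angle, so the copy
  determines that angle and with it the pair.\<close>

lemma copy_eq_iff: "copy \<alpha> n = copy \<beta> m \<longleftrightarrow> \<alpha> = \<beta> \<and> n = m"
proof
  assume eq: "copy \<alpha> n = copy \<beta> m"
  have le: "digit_sum (index_code \<beta> m) \<le> digit_sum (index_code \<alpha> n)" if eq: "copy \<alpha> n = copy \<beta> m" for \<alpha> n \<beta> m
  proof -
    define t where "t = digit_sum (index_code \<alpha> n)"
    have t: "0 \<le> t" "t \<le> 1/15" unfolding t_def by (rule digit_sum_bounds)+
    then have *: "\<bar>1/5 - t\<bar> \<le> 1" by auto
    have "circ (1/5 - t) \<in> copy \<alpha> n"
      unfolding circ_in_copy_iff[OF *] using code_angles(2) by (simp add: t_def)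
    then have "1/5 - t + digit_sum (index_code \<beta> m) \<in> code_angles"
      unfolding eq circ_in_copy_iff[OF *] .
    then have "1/5 - t + digit_sum (index_code \<beta> m) \<le> 1/5" using code_angles(1) by auto
    then show ?thesis by (simp add: t_def)
  qed
  show "\<alpha> = \<beta> \<and> n = m"
    unfolding inj_index_code[symmetric] by (rule order_antisym[OF le[OF eq[symmetric]] le[OF eq]])
qed auto

lemma copy_isometric: "isometric_copy (convex hull (circ ` code_angles)) (copy \<alpha> n)"
  unfolding copy_def by (rule isometric_copy_rotated)

end

section \<open>The cover and its indecomposability\<close>

theorem theorem7p1:
  fixes \<kappa> :: "'k rel"
  assumes "1 < CARD('n::finite)"
    and "Card_order \<kappa>" and "natLeq \<le>o \<kappa>" and "\<kappa> <o ctwo ^c natLeq"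
    and "MA_sigma_centered TYPE(real) \<kappa>"
  shows "\<exists>(C :: (real ^ 'n) set) (\<H> :: (real ^ 'n) set set).
    compact C \<and> convex C \<and>
    (\<forall>A\<in>\<H>. closed A \<and> isometric_copy C A) \<and>
    fold_cover \<kappa> \<H> \<and>
    \<not> splits_into_two_covers \<H>"
proof -
  have \<kappa>le: "\<kappa> \<le>o |UNIV :: (nat \<Rightarrow> bool) set|"
  proof -
    have "Func (UNIV :: nat set) (UNIV :: bool set) = UNIV" by (auto simp: Func_def)
    then have "ctwo ^c natLeq = |UNIV :: (nat \<Rightarrow> bool) set|"
      by (simp add: cexp_def ctwo_def Field_card_of Field_natLeq)
    then show ?thesis using assms(4) ordLess_imp_ordLeq by metis
  qed
  have "|Field \<kappa>| =o \<kappa>" by (rule card_of_Field_ordIso) fact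
  then have "|Field \<kappa>| \<le>o |UNIV :: (nat \<Rightarrow> bool) set|" using \<kappa>le ordIso_ordLeq_trans by blast
  \<comment> \<open>The \<kappa> chosen branches; they exist because \<kappa> is at most the
    continuum.\<close>
  then obtain A :: "(nat \<Rightarrow> bool) set" where "|Field \<kappa>| =o |A|"
    using internalize_card_of_ordLeq2[THEN iffD1] by blast
  then have A: "|A| =o \<kappa>"
    using \<open>|Field \<kappa>| =o \<kappa>\<close> ordIso_symmetric ordIso_transitive by blast
  have "natLeq \<le>o |A|" using assms(3) A ordIso_symmetric ordLeq_ordIso_trans by blast
  then have "infinite A" using infinite_iff_natLeq_ordLeq by blast
  then have inf: "infinite (Field \<kappa>)"
    using A \<open>|Field \<kappa>| =o |A|\<close> card_of_ordIso_finite by blast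
  have Anat: "|A \<times> (UNIV :: nat set)| \<le>o \<kappa>"
  proof (rule card_of_Times_ordLeq_infinite_Field[OF inf])
    show "|A| \<le>o \<kappa>" using A ordIso_imp_ordLeq by blast
    show "|UNIV :: nat set| \<le>o \<kappa>"
      using assms(3) card_of_nat ordIso_ordLeq_trans by blast
  qed (fact assms(2))
  obtain i j :: 'n where "i \<noteq> j"
    using assms(1) card_le_Suc0_iff_eq[of "UNIV :: 'n set"] by auto
  interpret plane "axis i 1 :: real ^ 'n" "axis j 1"
    by unfold_locales (use \<open>i \<noteq> j\<close> in \<open>auto simp: norm_eq_1 inner_axis_axis\<close>)
  define C where "C = convex hull (circ ` code_angles)"
  define \<H>\<^sub>0 where "\<H>\<^sub>0 = (\<lambda>(\<alpha>, n). copy \<alpha> n) ` (A \<times> UNIV)"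
  define X where "X = {p. norm p = 1 \<and> \<kappa> \<le>o |{S \<in> \<H>\<^sub>0. p \<in> S}| }"
  define \<H> where "\<H> = \<H>\<^sub>0 \<union> {S. isometric_copy C S \<and> S \<inter> X = {}}"
  have C: "compact C" "convex C"
    unfolding C_def using code_angles(4)
    by (auto intro!: compact_convex_hull compact_continuous_image continuous_intros simp: circ_def[abs_def])
  moreover have iso: "isometric_copy C S" if "S \<in> \<H>" for S
    using that copy_isometric by (auto simp: \<H>_def \<H>\<^sub>0_def C_def)
  moreover have "closed S" if "S \<in> \<H>" for S
    using isometric_copy_compact[OF C(1) iso[OF that]] by (rule compact_imp_closed)
  moreover have "fold_cover \<kappa> \<H>"
    unfolding fold_cover_def
  proof
    fix p :: "real ^ 'n"
    show "\<kappa> \<le>o |{S \<in> \<H>. p \<in> S}|"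
    proof (cases "p \<in> X")
      case True
      moreover have "|{S \<in> \<H>\<^sub>0. p \<in> S}| \<le>o |{S \<in> \<H>. p \<in> S}|"
        by (rule card_of_mono1) (auto simp: \<H>_def)
      ultimately show ?thesis unfolding X_def using ordLeq_transitive by blast
    next
      case False
      obtain Z :: "real \<Rightarrow> (real ^ 'n) set" where Z: "inj_on Z {0..1}"
        "\<And>s. s \<in> {0..1} \<Longrightarrow> p \<in> Z s \<and> isometric_copy C (Z s) \<and> (\<forall>y\<in>Z s. norm y = 1 \<longrightarrow> y = p)"
        by (rule many_copies[OF plane_axioms code_angles, of p, folded C_def]) (rule that)
      \<comment> \<open>Branches serve as parameters in the unit interval, so continuum many copies
        pass through \<open>p\<close>.\<close>
      define g where "g \<alpha> = Z (digit_sum {i. \<alpha> i})" for \<alpha> :: "nat \<Rightarrow> bool"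
      have unit: "digit_sum {i. \<alpha> i} \<in> {0..1}" for \<alpha> :: "nat \<Rightarrow> bool"
        using digit_sum_bounds[of "{i. \<alpha> i}"] by auto
      have "inj g"
      proof (rule injI)
        fix \<alpha> \<beta> assume "g \<alpha> = g \<beta>"
        then have "digit_sum {i. \<alpha> i} = digit_sum {i. \<beta> i}"
          unfolding g_def by (rule inj_onD[OF Z(1) _ unit unit])
        then show "\<alpha> = \<beta>" by (auto dest: injD[OF inj_digit_sum])
      qed
      \<comment> \<open>These copies avoid \<open>X\<close>: its elements are unit vectors, and the
        only unit vector such a copy can contain is \<open>p\<close>, which is not in
        \<open>X\<close>.\<close>
      moreover have "range g \<subseteq> {S \<in> \<H>. p \<in> S}"
        using Z(2)[OF unit] False unfolding g_def \<H>_def X_def by blast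
      ultimately have "|UNIV :: (nat \<Rightarrow> bool) set| \<le>o |{S \<in> \<H>. p \<in> S}|"
        unfolding card_of_ordLeq[symmetric] by blast
      then show ?thesis using \<kappa>le ordLeq_transitive by blast
    qed
  qed
  moreover have "\<not> splits_into_two_covers \<H>"
  proof
    assume "splits_into_two_covers \<H>"
    then obtain \<H>\<^sub>1 \<H>\<^sub>2 where part: "\<H>\<^sub>1 \<union> \<H>\<^sub>2 = \<H>" "\<H>\<^sub>1 \<inter> \<H>\<^sub>2 = {}"
      and cover: "\<Union>\<H>\<^sub>1 = UNIV" "\<Union>\<H>\<^sub>2 = UNIV"
      unfolding splits_into_two_covers_def by blast
    \<comment> \<open>the witness is a point of \<open>X\<close>, so the added copies do not contain it\<close>
    have mono: "\<exists>p. \<forall>S\<in>\<H>. p \<in> S \<longrightarrow> S \<in> \<G>"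
      if B: "B \<subseteq> A" "\<kappa> \<le>o |B|" "\<And>\<alpha>. \<alpha> \<in> B \<Longrightarrow> infinite {n. copy \<alpha> n \<in> \<G>}" for B \<G>
    proof -
      obtain x where x: "\<And>\<alpha>. \<alpha> \<in> B \<Longrightarrow> \<exists>n. copy \<alpha> n \<in> \<G> \<and> last_node x \<alpha> n"
        "\<And>\<alpha> n. \<alpha> \<in> A - B \<Longrightarrow> \<not> last_node x \<alpha> n"
        by (rule almost_disjoint_coding[where Q = "\<lambda>\<alpha> n. copy \<alpha> n \<in> \<G>", OF assms(5) Anat B(1)]) (erule B(3), rule that)
      then obtain n where n: "\<And>\<alpha>. \<alpha> \<in> B \<Longrightarrow> copy \<alpha> (n \<alpha>) \<in> \<G> \<and> last_node x \<alpha> (n \<alpha>)" by metis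
      let ?p = "circ (digit_sum (point_code x))"
      have "inj_on (\<lambda>\<alpha>. copy \<alpha> (n \<alpha>)) B" by (rule inj_onI) (simp add: copy_eq_iff)
      moreover have "(\<lambda>\<alpha>. copy \<alpha> (n \<alpha>)) ` B \<subseteq> {S \<in> \<H>\<^sub>0. ?p \<in> S}"
        using n B(1) by (auto simp: circ_in_copy \<H>\<^sub>0_def)
      ultimately have "|B| \<le>o |{S \<in> \<H>\<^sub>0. ?p \<in> S}|"
        unfolding card_of_ordLeq[symmetric] by blast
      then have "?p \<in> X" using B(2) ordLeq_transitive by (auto simp: X_def)
      have "S \<in> \<G>" if S: "S \<in> \<H>" "?p \<in> S" for S
      proof -
        have "S \<in> \<H>\<^sub>0" using S \<open>?p \<in> X\<close> unfolding \<H>_def by blast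
        then obtain \<alpha> m where \<alpha>: "S = copy \<alpha> m" "\<alpha> \<in> A"
          unfolding \<H>\<^sub>0_def by auto
        \<comment> \<open>Only branches in \<open>B\<close> have a last node, and it is unique, so
          \<open>S\<close> is the copy chosen in the given subfamily.\<close>
        then have "last_node x \<alpha> m" using S circ_in_copy by blast
        moreover from this have "\<alpha> \<in> B" using x(2)[of \<alpha> m] \<alpha>(2) by blast
        ultimately have "m = n \<alpha>" using n[of \<alpha>] last_node_unique by blast
        then show ?thesis using \<alpha>(1) n[OF \<open>\<alpha> \<in> B\<close>] by simp
      qed
      then show ?thesis by blast
    qed
    \<comment> \<open>For the branches of \<open>A\<close> outside \<open>B\<close>, all but
      finitely many levels give copies in \<open>\<H>\<^sub>2\<close>.\<close>
    define B where "B = {\<alpha> \<in> A. infinite {n. copy \<alpha> n \<in> \<H>\<^sub>1}}"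
    have BA: "B \<subseteq> A" by (simp add: B_def)
    \<comment> \<open>An infinite cardinal is not the union of two smaller sets.\<close>
    have "\<kappa> \<le>o |B| \<or> \<kappa> \<le>o |A - B|"
    proof (rule ccontr)
      assume "\<not> ?thesis"
      then have "|B| <o \<kappa>" "|A - B| <o \<kappa>"
        using not_ordLeq_iff_ordLess[OF card_of_Well_order card_order_on_well_order_on[OF assms(2)]]
        by blast+
      then have "|B \<union> (A - B)| <o \<kappa>"
        using card_of_Un_ordLess_infinite_Field[OF inf assms(2)] by blast
      moreover have "B \<union> (A - B) = A" by (auto simp: B_def)
      ultimately have "|A| <o \<kappa>" by simp
      then show False using A not_ordLess_ordIso by blast
    qed
    then show False
    proof
      assume *: "\<kappa> \<le>o |B|"
      have inf\<^sub>1: "infinite {n. copy \<alpha> n \<in> \<H>\<^sub>1}" if "\<alpha> \<in> B" for \<alpha>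
        using that by (simp add: B_def)
      have "\<exists>p. \<forall>S\<in>\<H>. p \<in> S \<longrightarrow> S \<in> \<H>\<^sub>1"
        using BA * inf\<^sub>1 by (rule mono)
      then obtain p where "\<forall>S\<in>\<H>. p \<in> S \<longrightarrow> S \<in> \<H>\<^sub>1" ..
      \<comment> \<open>Some member of \<open>\<H>\<^sub>2\<close> contains \<open>p\<close>; it
        would belong to \<open>\<H>\<^sub>1\<close> too, against disjointness.\<close>
      then show False using part cover(2) by blast
    next
      assume *: "\<kappa> \<le>o |A - B|"
      have inf\<^sub>2: "infinite {n. copy \<alpha> n \<in> \<H>\<^sub>2}" if "\<alpha> \<in> A - B" for \<alpha>
      proof -
        have "finite {n. copy \<alpha> n \<in> \<H>\<^sub>1}" using that by (auto simp: B_def)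
        moreover have "{n. copy \<alpha> n \<in> \<H>\<^sub>1} \<union> {n. copy \<alpha> n \<in> \<H>\<^sub>2} = UNIV"
          using that part(1) by (auto simp: \<H>_def \<H>\<^sub>0_def)
        ultimately show ?thesis by (metis finite_Un infinite_UNIV_nat)
      qed
      have "\<exists>p. \<forall>S\<in>\<H>. p \<in> S \<longrightarrow> S \<in> \<H>\<^sub>2"
        using Diff_subset * inf\<^sub>2 by (rule mono)
      then obtain p where "\<forall>S\<in>\<H>. p \<in> S \<longrightarrow> S \<in> \<H>\<^sub>2" ..
      then show False using part cover(1) by blast
    qed
  qed
  ultimately show ?thesis by blast
qed

end
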